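(* For every oriented graph $D$, $\operatorname{inv}(D) \leq \tau'(D)$ and $\operatorname{inv}(D) \leq 2\tau(D)$.
   Context: An oriented graph is a digraph with no loops, no multiple arcs and no directed cycle of length 2. For a digraph $D$ and $X\subseteq V(D)$, inverting $X$ means reversing the direction of every arc with both ends in $X$. A decycling family of an oriented graph $D$ is a finite family of subsets of $V(D)$ such that inverting them one after another yields an acyclic digraph; the inversion number $\operatorname{inv}(D)$ is the minimum size of a decycling family (the empty digraph has inversion number $0$). $\tau(D)$ (cycle transversal number) is the minimum number of vertices whose deletion makes $D$ acyclic, and $\tau'(D)$ (cycle arc-transversal number) is the minimum number of arcs whose deletion makes $D$ acyclic. *)

theory Defs
  imports "Graph_Theory.Graph_Theory"
begin

text \<open>The locale \<^locale>\<open>digraph\<close> covers finite digraphs, the null digraph included, without loops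
  and without parallel arcs.\<close>

locale oriented_graph = digraph +
  assumes no_two_cycle: "u \<rightarrow> v \<Longrightarrow> \<not> v \<rightarrow> u"

definition acyclic_digraph :: "('a, 'b) pre_digraph \<Rightarrow> bool" where
  "acyclic_digraph D \<longleftrightarrow> \<not> (\<exists>p. pre_digraph.cycle D p)"

text \<open>Reversing an arc keeps its identity as an element of \<^term>\<open>arcs D\<close> and exchanges its tail
  and head.\<close>

definition invert :: "('a, 'b) pre_digraph \<Rightarrow> 'a set \<Rightarrow> ('a, 'b) pre_digraph" where
  "invert D X = D
     \<lparr> tail := \<lambda>e. if tail D e \<in> X \<and> head D e \<in> X then head D e else tail D e,
       head := \<lambda>e. if tail D e \<in> X \<and> head D e \<in> X then tail D e else head D e \<rparr>"

definition decycling_family :: "('a, 'b) pre_digraph \<Rightarrow> 'a set list \<Rightarrow> bool" where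
  "decycling_family D Xs \<longleftrightarrow>
     (\<forall>X \<in> set Xs. X \<subseteq> verts D) \<and> acyclic_digraph (foldl invert D Xs)"

definition inversion_number :: "('a, 'b) pre_digraph \<Rightarrow> nat" where
  "inversion_number D = (LEAST k. \<exists>Xs. decycling_family D Xs \<and> length Xs = k)"

definition delete_verts :: "('a, 'b) pre_digraph \<Rightarrow> 'a set \<Rightarrow> ('a, 'b) pre_digraph" where
  "delete_verts D S = D \<restriction> (verts D - S)"

definition delete_arcs :: "('a, 'b) pre_digraph \<Rightarrow> 'b set \<Rightarrow> ('a, 'b) pre_digraph" where
  "delete_arcs D F = D \<lparr> arcs := arcs D - F \<rparr>"

definition cycle_transversal_number :: "('a, 'b) pre_digraph \<Rightarrow> nat" where
  "cycle_transversal_number D =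
     (LEAST k. \<exists>S \<subseteq> verts D. finite S \<and> card S = k \<and> acyclic_digraph (delete_verts D S))"

definition cycle_arc_transversal_number :: "('a, 'b) pre_digraph \<Rightarrow> nat" where
  "cycle_arc_transversal_number D =
     (LEAST k. \<exists>F \<subseteq> arcs D. finite F \<and> card F = k \<and> acyclic_digraph (delete_arcs D F))"

end

theory Submission
  imports Defs
begin

text \<open>
  Both bounds repair one element of a transversal at a time. If deleting an arc \<open>e\<close> (together with
  other arcs) leaves an acyclic digraph, then putting \<open>e\<close> back in one of its two directions keeps it
  acyclic, and inverting the pair of ends of \<open>e\<close> reverses \<open>e\<close> alone; so one inversion per arc suffices.
  For a vertex \<open>s\<close> with out-neighbourhood \<open>N\<close>, inverting \<open>N \<union> {s}\<close> and then \<open>N\<close> reverses exactly the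
  arcs leaving \<open>s\<close>. This makes \<open>s\<close> a sink, which lies on no cycle; so two inversions per vertex suffice.
\<close>

text \<open>No pair of the union starts in \<open>s\<close>, so a walk can use a new pair only as
  its last step; it then ends in \<open>s\<close> and has started elsewhere, hence is not
  closed.\<close>

lemma acyclic_Un_sink:
  assumes "acyclic R" "s \<notin> Domain R" "s \<notin> A"
  shows "acyclic (R \<union> A \<times> {s})"
proof -
  have "(x, y) \<in> R\<^sup>+ \<or> (y = s \<and> x \<noteq> s)" if "(x, y) \<in> (R \<union> A \<times> {s})\<^sup>+" for x y
    using that
  proof induction
    case (base y)
    then show ?case using assms by auto
  next
    case (step y z)
    have "y \<noteq> s" using step.hyps(2) assms by auto
    then have xy: "(x, y) \<in> R\<^sup>+" using step.IH by blast
    then have "x \<noteq> s" using assms(2) by (metis DomainI tranclD)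
    then show ?case using step.hyps(2) xy by (auto intro: trancl_into_trancl)
  qed
  then show ?thesis using assms(1) unfolding acyclic_def by blast
qed

text \<open>If both insertions closed a cycle, \<open>R\<close> would contain walks from
  \<open>u\<close> to \<open>v\<close> and back, and these join to a closed walk because
  \<open>u\<close> and \<open>v\<close> differ.\<close>

lemma acyclic_insert_either:
  assumes "acyclic R" "u \<noteq> v"
  shows "acyclic (insert (u, v) R) \<or> acyclic (insert (v, u) R)"
proof (rule ccontr)
  assume "\<not> ?thesis"
  then have "(u, v) \<in> R\<^sup>*" "(v, u) \<in> R\<^sup>*" using assms(1) by (auto simp: acyclic_insert)
  then show False using assms acyclic_impl_antisym_rtrancl[of R] by (auto dest: antisymD)
qed

text \<open>Every nonempty closed walk contains a cycle, so acyclicity depends only on the adjacency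
  relation. This turns all later arguments into ones about relations.\<close>

lemma (in wf_digraph) acyclic_digraph_iff: "acyclic_digraph G \<longleftrightarrow> acyclic (arcs_ends G)"
proof -
  have "(\<exists>p. cycle p) \<longleftrightarrow> (\<exists>u. u \<rightarrow>\<^sup>+ u)"
    unfolding reachable1_awalk using closed_w_imp_cycle
    by (auto simp: closed_w_def cycle_def)
  then show ?thesis unfolding acyclic_digraph_def acyclic_def by auto
qed

lemma verts_invert [simp]: "verts (invert D X) = verts D"
  and arcs_invert [simp]: "arcs (invert D X) = arcs D"
  and tail_invert: "tail (invert D X) e = (if tail D e \<in> X \<and> head D e \<in> X then head D e else tail D e)"
  and head_invert: "head (invert D X) e = (if tail D e \<in> X \<and> head D e \<in> X then tail D e else head D e)"
  by (simp_all add: invert_def)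

context oriented_graph
begin

text \<open>Two arcs on the same pair of vertices would be parallel or form a 2-cycle.\<close>

lemma arc_eq_if_same_ends:
  assumes "e \<in> arcs G" "f \<in> arcs G" "{tail G e, head G e} = {tail G f, head G f}"
  shows "e = f"
proof -
  have "tail G e \<rightarrow> head G e" "tail G f \<rightarrow> head G f"
    using assms(1,2) by (simp_all add: arcs_ends_conv)
  then have "arc_to_ends G e = arc_to_ends G f"
    using assms(3) no_two_cycle by (auto simp: doubleton_eq_iff arc_to_ends_def)
  then show ?thesis using assms no_multi_arcs by blast
qed

text \<open>Inversion preserves the unordered pair of ends of each arc, so parallel arcs or a
  2-cycle after inversion would already be two arcs of \<open>G\<close> on one pair. This lets the
  inductions below continue in the inverted digraph.\<close>

lemma oriented_graph_invert: "oriented_graph (invert G X)"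
proof -
  have ends: "{tail (invert G X) e, head (invert G X) e} = {tail G e, head G e}" for e
    by (auto simp: tail_invert head_invert)
  have loopfree: "tail (invert G X) e \<noteq> head (invert G X) e" if "e \<in> arcs G" for e
    using no_loops[OF that] by (auto simp: tail_invert head_invert)
  show ?thesis
  proof
    fix e1 e2
    assume "e1 \<in> arcs (invert G X)" "e2 \<in> arcs (invert G X)"
      "arc_to_ends (invert G X) e1 = arc_to_ends (invert G X) e2"
    then show "e1 = e2"
      using ends[of e1] ends[of e2] arc_eq_if_same_ends[of e1 e2] by (simp add: arc_to_ends_def)
  next
    fix u v
    assume "u \<rightarrow>\<^bsub>invert G X\<^esub> v"
    then obtain e where e: "e \<in> arcs G" "tail (invert G X) e = u" "head (invert G X) e = v"
      by (auto simp: arcs_ends_conv)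
    show "\<not> v \<rightarrow>\<^bsub>invert G X\<^esub> u"
    proof
      assume "v \<rightarrow>\<^bsub>invert G X\<^esub> u"
      then obtain f where f: "f \<in> arcs G" "tail (invert G X) f = v" "head (invert G X) f = u"
        by (auto simp: arcs_ends_conv)
      have "e = f"
        using e f ends[of e] ends[of f] arc_eq_if_same_ends[of e f] by (simp add: insert_commute)
      then show False using e f loopfree[of e] by simp
    qed
  qed (simp_all add: loopfree, simp_all add: tail_invert head_invert)
qed

text \<open>An arc with both ends in the pair is no loop, so it joins the two vertices of the pair
  and must be \<open>e\<close>.\<close>

lemma invert_arc_ends:
  assumes "e \<in> arcs G" "f \<in> arcs G"
  shows "tail (invert G {tail G e, head G e}) f = (if f = e then head G e else tail G f)"
    and "head (invert G {tail G e, head G e}) f = (if f = e then tail G e else head G f)"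
proof -
  have "tail G f \<in> {tail G e, head G e} \<and> head G f \<in> {tail G e, head G e} \<longleftrightarrow> f = e"
    using arc_eq_if_same_ends[OF assms] no_loops[OF assms(2)] by fastforce
  then show "tail (invert G {tail G e, head G e}) f = (if f = e then head G e else tail G f)"
    and "head (invert G {tail G e, head G e}) f = (if f = e then tail G e else head G f)"
    by (simp_all only: tail_invert head_invert split: if_split) simp_all
qed

text \<open>Arcs inside \<open>N\<close> are reversed twice and arcs from \<open>s\<close> to
  \<open>N\<close> only once, as \<open>s\<close> is not in \<open>N\<close>. An arc into
  \<open>s\<close> has its tail outside \<open>N\<close>, since there is no 2-cycle, and stays as it
  is.\<close>

lemma invert_out_neighbourhood:
  fixes s :: 'a
  assumes "f \<in> arcs G"
  defines "N \<equiv> {v. s \<rightarrow> v}"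
  shows "tail (invert (invert G (insert s N)) N) f = (if tail G f = s then head G f else tail G f)"
    and "head (invert (invert G (insert s N)) N) f = (if tail G f = s then s else head G f)"
proof -
  have f: "tail G f \<rightarrow> head G f" using assms(1) by (simp add: arcs_ends_conv)
  have "s \<notin> N" unfolding N_def using adj_not_same by blast
  moreover have "tail G f = s \<Longrightarrow> head G f \<in> N" "head G f = s \<Longrightarrow> tail G f \<notin> N"
    unfolding N_def using f no_two_cycle by auto
  moreover have "tail G f \<noteq> head G f" using no_loops assms(1) by blast
  ultimately show "tail (invert (invert G (insert s N)) N) f = (if tail G f = s then head G f else tail G f)"
    and "head (invert (invert G (insert s N)) N) f = (if tail G f = s then s else head G f)"
    by (auto simp: tail_invert head_invert)
qed

lemma acyclic_delete_arcs_iff: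
  "acyclic_digraph (delete_arcs G F) \<longleftrightarrow> acyclic ((\<lambda>e. (tail G e, head G e)) ` (arcs G - F))"
proof -
  interpret H: wf_digraph "delete_arcs G F" by unfold_locales (auto simp: delete_arcs_def)
  show ?thesis unfolding H.acyclic_digraph_iff arcs_ends_conv by (simp add: delete_arcs_def)
qed

lemma acyclic_delete_verts_iff:
  "acyclic_digraph (delete_verts G S) \<longleftrightarrow>
     acyclic ((\<lambda>e. (tail G e, head G e)) ` {e \<in> arcs G. tail G e \<notin> S \<and> head G e \<notin> S})"
proof -
  interpret H: wf_digraph "delete_verts G S" by unfold_locales (auto simp: delete_verts_def)
  have "{e \<in> arcs G. tail G e \<in> verts G - S \<and> head G e \<in> verts G - S} =
      {e \<in> arcs G. tail G e \<notin> S \<and> head G e \<notin> S}"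
    by auto
  then show ?thesis
    unfolding H.acyclic_digraph_iff arcs_ends_conv by (simp add: delete_verts_def)
qed

end

lemma decycling_family_Cons:
  "decycling_family D (X # Xs) \<longleftrightarrow> X \<subseteq> verts D \<and> decycling_family (invert D X) Xs"
  by (auto simp: decycling_family_def)

text \<open>\<open>D\<close> varies in the induction because the remaining arcs may have to be
  treated after an inversion; \<open>F\<close> still makes sense there, as arcs keep their identity.
  An arc that can return in its own direction costs nothing, hence only an inequality.\<close>

lemma decycling_family_if_arc_transversal:
  assumes "finite F" "oriented_graph D" "F \<subseteq> arcs D" "acyclic_digraph (delete_arcs D F)"
  shows "\<exists>Xs. decycling_family D Xs \<and> length Xs \<le> card F"
  using assms
proof (induction F arbitrary: D rule: finite_induct)
  case empty
  then have "decycling_family D []" by (simp add: decycling_family_def delete_arcs_def)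
  then show ?case by (intro exI[of _ "[]"]) simp
next
  case (insert e F)
  interpret oriented_graph D by fact
  let ?X = "{tail D e, head D e}" and ?ends = "\<lambda>D e. (tail D e, head D e)"
  have e: "e \<in> arcs D" and F: "F \<subseteq> arcs D" using insert.prems by auto
  have arcs: "arcs D - F = insert e (arcs D - insert e F)" using e insert.hyps by auto
  interpret I: oriented_graph "invert D ?X" by (rule oriented_graph_invert)
  have inv: "?ends (invert D ?X) ` (arcs D - F) =
      insert (head D e, tail D e) (?ends D ` (arcs D - insert e F))"
    unfolding arcs using e by (auto simp: invert_arc_ends image_iff)
  have "acyclic (?ends D ` (arcs D - insert e F))"
    using insert.prems acyclic_delete_arcs_iff by blast
  \<comment> \<open>Restoring \<open>e\<close> in its own direction gives \<open>D\<close> without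
    \<open>F\<close>; restoring it reversed gives the inverted digraph without
    \<open>F\<close>.\<close>
  from acyclic_insert_either[OF this no_loops[OF e]]
  consider "acyclic_digraph (delete_arcs D F)"
    | "acyclic_digraph (delete_arcs (invert D ?X) F)"
    unfolding acyclic_delete_arcs_iff I.acyclic_delete_arcs_iff arcs_invert inv
    by (auto simp: arcs)
  then show ?case
  proof cases
    case 1
    then obtain Xs where "decycling_family D Xs" "length Xs \<le> card F"
      using insert.IH insert.prems F by blast
    then show ?thesis using insert.hyps by (intro exI[of _ Xs]) auto
  next
    case 2
    then obtain Xs where "decycling_family (invert D ?X) Xs" "length Xs \<le> card F"
      using insert.IH[OF I.oriented_graph_axioms] F by auto
    then show ?thesis
      using insert.hyps e by (intro exI[of _ "?X # Xs"]) (auto simp: decycling_family_Cons)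
  qed
qed

lemma decycling_family_if_transversal:
  assumes "finite S" "oriented_graph D" "S \<subseteq> verts D" "acyclic_digraph (delete_verts D S)"
  shows "\<exists>Xs. decycling_family D Xs \<and> length Xs = 2 * card S"
  using assms
proof (induction S arbitrary: D rule: finite_induct)
  case empty
  interpret oriented_graph D by fact
  have "decycling_family D []"
    using empty.prems(3) unfolding acyclic_delete_verts_iff
    by (simp add: decycling_family_def acyclic_digraph_iff arcs_ends_conv)
  then show ?case by (intro exI[of _ "[]"]) simp
next
  case (insert s S)
  interpret oriented_graph D by fact
  define N where "N = {v. s \<rightarrow>\<^bsub>D\<^esub> v}"
  have N: "N \<subseteq> verts D" unfolding N_def by auto
  let ?E = "invert (invert D (insert s N)) N"
  interpret E1: oriented_graph "invert D (insert s N)" by (rule oriented_graph_invert)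
  interpret E: oriented_graph ?E by (rule E1.oriented_graph_invert)
  let ?R = "(\<lambda>e. (tail D e, head D e)) ` {e \<in> arcs D. tail D e \<notin> insert s S \<and> head D e \<notin> insert s S}"
  have "acyclic ?R" using insert.prems acyclic_delete_verts_iff by blast
  \<comment> \<open>All conceivable arcs into \<open>s\<close> are allowed at once, so the exact
    in-neighbourhood of \<open>s\<close> after the two inversions need not be computed.\<close>
  then have "acyclic (?R \<union> (- {s}) \<times> {s})" by (rule acyclic_Un_sink) auto
  moreover have "(\<lambda>e. (tail ?E e, head ?E e)) ` {e \<in> arcs ?E. tail ?E e \<notin> S \<and> head ?E e \<notin> S}
      \<subseteq> ?R \<union> (- {s}) \<times> {s}"
  proof (intro image_subsetI)
    fix e
    assume "e \<in> {e \<in> arcs ?E. tail ?E e \<notin> S \<and> head ?E e \<notin> S}"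
    then have e: "e \<in> arcs D" "tail ?E e \<notin> S" "head ?E e \<notin> S" by simp_all
    note E = invert_out_neighbourhood[OF e(1), of s, folded N_def]
    show "(tail ?E e, head ?E e) \<in> ?R \<union> (- {s}) \<times> {s}"
    proof (cases "tail D e = s \<or> head D e = s")
      \<comment> \<open>Every arc of \<open>D\<close> at \<open>s\<close> now points into
        \<open>s\<close>, from a vertex other than \<open>s\<close>.\<close>
      case True
      then show ?thesis unfolding E using no_loops[OF e(1)] by auto
    next
      case False
      then show ?thesis using e unfolding E by auto
    qed
  qed
  ultimately have "acyclic_digraph (delete_verts ?E S)"
    unfolding E.acyclic_delete_verts_iff by (rule acyclic_subset)
  then obtain Xs where "decycling_family ?E Xs" "length Xs = 2 * card S"
    using insert.IH[OF E.oriented_graph_axioms] insert.prems(2) by auto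
  then show ?case
    using insert.hyps N insert.prems(2)
    by (intro exI[of _ "insert s N # N # Xs"]) (auto simp: decycling_family_Cons)
qed

theorem theorem1p1:
  fixes D :: "('a, 'b) pre_digraph"
  assumes "oriented_graph D"
  shows "inversion_number D \<le> cycle_arc_transversal_number D \<and>
         inversion_number D \<le> 2 * cycle_transversal_number D"
proof -
  interpret oriented_graph D by fact
  have upper: "inversion_number D \<le> length Xs" if "decycling_family D Xs" for Xs
    unfolding inversion_number_def by (rule Least_le) (use that in blast)
  \<comment> \<open>The set of all arcs is a transversal, so the minimum defining the arc
    transversal number is attained; the set of all vertices serves likewise below.\<close>
  have "acyclic_digraph (delete_arcs D (arcs D))"
    by (simp add: acyclic_delete_arcs_iff acyclic_def)
  then have "\<exists>k. \<exists>F \<subseteq> arcs D. finite F \<and> card F = k \<and> acyclic_digraph (delete_arcs D F)"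
    using finite_arcs by blast
  from LeastI_ex[OF this] obtain F where "F \<subseteq> arcs D" "finite F"
    "card F = cycle_arc_transversal_number D" "acyclic_digraph (delete_arcs D F)"
    unfolding cycle_arc_transversal_number_def by blast
  moreover from this obtain Xs where "decycling_family D Xs" "length Xs \<le> card F"
    using decycling_family_if_arc_transversal assms by blast
  ultimately have "inversion_number D \<le> cycle_arc_transversal_number D"
    using upper by fastforce
  have "{e \<in> arcs D. tail D e \<notin> verts D \<and> head D e \<notin> verts D} = {}" by auto
  then have "acyclic_digraph (delete_verts D (verts D))"
    unfolding acyclic_delete_verts_iff by (simp only: image_empty acyclic_def) simp
  then have "\<exists>k. \<exists>S \<subseteq> verts D. finite S \<and> card S = k \<and> acyclic_digraph (delete_verts D S)"
    using finite_verts by blast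
  from LeastI_ex[OF this] obtain S where "S \<subseteq> verts D" "finite S"
    "card S = cycle_transversal_number D" "acyclic_digraph (delete_verts D S)"
    unfolding cycle_transversal_number_def by blast
  moreover from this obtain Ys where "decycling_family D Ys" "length Ys = 2 * card S"
    using decycling_family_if_transversal assms by blast
  ultimately have "inversion_number D \<le> 2 * cycle_transversal_number D"
    using upper by fastforce
  with \<open>inversion_number D \<le> cycle_arc_transversal_number D\<close> show ?thesis by blast
qed

end
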